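(* Consider the $T$-period setting described in the context. Assume: (Irreversible treatment) For all $t\in\mathcal{T}\setminus\{T\}$, $D_{i,t}=1\implies D_{i,t+1}=1$. (Exclusion) For each $t\in\mathcal{T}$ and $z\in\{0,1\}$, $Y_{i,t}(0,z)=Y_{i,t}(0)$ and $Y_{i,t}(1,\tau,z)=Y_{i,t}(1,\tau)$ for all $\tau\in\{0,\dots,t-1\}$ (that is, potential outcomes do not depend on $z$). (Independence) For all $t\in\mathcal{T}$, $\big(Y_{i,t}(0),Y_{i,t}(1,0),\dots,Y_{i,t}(1,t-1),D_{i,1}(1),D_{i,1}(0),\dots,D_{i,t}(1),D_{i,t}(0)\big)$ is independent of $Z_i$. (Relevance at $t=1$) $FS_1\neq 0$. (Monotonicity at $t=1$) $\mathbb{P}(F_1)=0$. (Homogeneity) For all $t\in\mathcal{T}$ and $\tau\in\{0,\dots,t-1\}$, $\Delta_t^\tau(C_1)=\Delta^\tau(C_1)$, i.e. $\Delta_t^\tau(C_1)$ does not depend on $t$. Moreover, for each $t\in\mathcal{T}\setminus\{1\}$ and $\tau\in\{0,\dots,t-2\}$, for any latent group $g\in\mathcal{G}_{t-\tau}$ such that $\mathbb{P}(g)>0$, $\Delta^\tau(C_1)=\Delta_t^\tau(g)$. Then $$\mathbf{\Delta}=\mathbf{P}^{-1}\mathbf{RF},$$ where $\mathbf{\Delta}=(\Delta^0(C_1),\dots,\Delta^{T-1}(C_1))'$, $\mathbf{RF}=(RF_1,\dots,RF_T)'$, and $\mathbf{P}$ is the (invertible) lower triangular $T\times T$ matrix $$\mathbf{P}=\begin{bmatrix}FS_1&0&\cdots&0\\-\rho_2&FS_1&\cdots&0\\\vdots&\vdots&\ddots&\vdots\\-\rho_T&-\rho_{T-1}&\cdots&FS_1\end{bmatrix},$$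 i.e. $\mathbf{P}_{tt}=FS_1$, $\mathbf{P}_{ts}=-\rho_{t-s+1}$ for $s<t$, and $\mathbf{P}_{ts}=0$ for $s>t$, with $\rho_t=\mathbb{P}(D_{i,t}>D_{i,t-1}\mid Z_i=0)-\mathbb{P}(D_{i,t}>D_{i,t-1}\mid Z_i=1)$ for $t\in\mathcal{T}\setminus\{1\}$.
   Context: Setting. Time is $t\in\mathcal{T}=\{1,\dots,T\}$; $i$ denotes a generic observation. $Z_i\in\{0,1\}$ is a time-invariant binary instrument with $0<\mathbb{P}(Z_i=1)<1$. $D_{i,t}(z)\in\{0,1\}$ is the potential treatment status at $t$ under instrument value $z$, and the observed status is $D_{i,t}=D_{i,t}(Z_i)$. No unit is treated before period 1. $Y_{i,t}(0,z)$ is the potential outcome at $t$ if $i$ has not been treated up to $t$ and the instrument is $z$; $Y_{i,t}(1,\tau,z)$, $\tau\in\{0,\dots,t-1\}$, is the potential outcome at $t$ if $i$ is first treated at period $t-\tau$ and the instrument is $z$. The observed outcome $Y_{i,t}$ equals $Y_{i,t}(0,Z_i)$ if $i$ has not been treated up to $t$, and $Y_{i,t}(1,t-s,Z_i)$ if $i$ was first treated at $s\le t$. All expectations written are assumed to exist (one may take all potential outcomes to be integrable). Latent types at $t$ (events): $AT_t=\{D_{i,t}(1)=D_{i,t}(0)=1\}$, $C_t=\{D_{i,t}(1)>D_{i,t}(0)\}$, $F_t=\{D_{i,t}(1)<D_{i,t}(0)\}$, $NT_t=\{D_{i,t}(1)=D_{i,t}(0)=0\}$. $C_{t:t'}$ means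 complier in every period from $t$ to $t'$ ($\bigcap_{s=t}^{t'}C_s$), similarly $F_{t:t'}$, $NT_{t:t'}$; a tuple denotes the intersection of its entries. Sets of latent groups: $\mathcal{G}^+_2=\{(NT_1,C_2)\}$, $\mathcal{G}^-_2=\{(C_1,AT_2),(NT_1,F_2)\}$, and for $t\in\mathcal{T}\setminus\{1,2\}$, $$\mathcal{G}^+_t=\{(NT_{1:t-1},C_t),\ (NT_{1:\ell-1},F_{\ell:t-1},AT_t):\ell=2,\dots,t-1\},$$ $$\mathcal{G}^-_t=\{(C_{1:t-1},AT_t),\ (NT_{1:t-1},F_t),\ (NT_{1:\ell-1},C_{\ell:t-1},AT_t):\ell=2,\dots,t-1\}.$$ For $t\in\mathcal{T}\setminus\{1\}$, $\mathcal{G}_t=\mathcal{G}^+_t\cup\mathcal{G}^-_t$. Estimands: $RF_t=\mathbb{E}[Y_{i,t}\mid Z_i=1]-\mathbb{E}[Y_{i,t}\mid Z_i=0]$ and $FS_t=\mathbb{E}[D_{i,t}\mid Z_i=1]-\mathbb{E}[D_{i,t}\mid Z_i=0]$. Causal effects (under exclusion): for a latent group $g$, $\Delta_t^\tau(g)=\mathbb{E}[Y_{i,t}(1,\tau)-Y_{i,t}(0)\mid g]$. *)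

theory Defs
  imports "HOL-Probability.Probability" "Jordan_Normal_Form.Gauss_Jordan_Elimination"
begin

text \<open>
  The law of the generic observation is a probability space \<open>M\<close>; every variable of the model is a
  function on its sample space.  Instrument values and treatment statuses in \<open>{0, 1}\<close> are
  represented by \<^typ>\<open>bool\<close>, whose order has \<open>False < True\<close>.

  \<^item> \<open>Z\<close> is the instrument;
  \<^item> \<open>D t z\<close> is the potential treatment status at \<open>t\<close> under instrument value \<open>z\<close>;
  \<^item> \<open>Y0 t z\<close> and \<open>Y1 t \<tau> z\<close> are the potential outcomes \<open>Y_t(0, z)\<close> and \<open>Y_t(1, \<tau>, z)\<close>;
  \<^item> \<open>Y0x t\<close> and \<open>Y1x t \<tau>\<close> are the potential outcomes \<open>Y_t(0)\<close> and \<open>Y_t(1, \<tau>)\<close> indexed without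
    an instrument value, available under exclusion.

  Periods are the natural numbers \<open>1, \<dots>, T\<close>; the values of \<open>D\<close>, \<open>Y0\<close> and \<open>Y1\<close> at other periods
  are never used.
\<close>

type_synonym 'a treatment = "nat \<Rightarrow> bool \<Rightarrow> 'a \<Rightarrow> bool"

definition obs_D :: "('a \<Rightarrow> bool) \<Rightarrow> 'a treatment \<Rightarrow> nat \<Rightarrow> 'a \<Rightarrow> bool" where
  "obs_D Z D t \<omega> = D t (Z \<omega>) \<omega>"

definition first_treated :: "('a \<Rightarrow> bool) \<Rightarrow> 'a treatment \<Rightarrow> 'a \<Rightarrow> nat" where
  "first_treated Z D \<omega> = (LEAST s. 1 \<le> s \<and> obs_D Z D s \<omega>)"

definition obs_Y ::
  "('a \<Rightarrow> bool) \<Rightarrow> 'a treatment \<Rightarrow> (nat \<Rightarrow> bool \<Rightarrow> 'a \<Rightarrow> real) \<Rightarrow> (nat \<Rightarrow> nat \<Rightarrow> bool \<Rightarrow> 'a \<Rightarrow> real)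
    \<Rightarrow> nat \<Rightarrow> 'a \<Rightarrow> real" where
  "obs_Y Z D Y0 Y1 t \<omega> =
     (if \<exists>s\<in>{1..t}. obs_D Z D s \<omega> then Y1 t (t - first_treated Z D \<omega>) (Z \<omega>) \<omega>
      else Y0 t (Z \<omega>) \<omega>)"

definition AT :: "'a measure \<Rightarrow> 'a treatment \<Rightarrow> nat \<Rightarrow> 'a set" where
  "AT M D t = {\<omega> \<in> space M. D t True \<omega> \<and> D t False \<omega>}"

definition CO :: "'a measure \<Rightarrow> 'a treatment \<Rightarrow> nat \<Rightarrow> 'a set" where
  "CO M D t = {\<omega> \<in> space M. D t True \<omega> > D t False \<omega>}"

definition DF :: "'a measure \<Rightarrow> 'a treatment \<Rightarrow> nat \<Rightarrow> 'a set" where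
  "DF M D t = {\<omega> \<in> space M. D t True \<omega> < D t False \<omega>}"

definition NT :: "'a measure \<Rightarrow> 'a treatment \<Rightarrow> nat \<Rightarrow> 'a set" where
  "NT M D t = {\<omega> \<in> space M. \<not> D t True \<omega> \<and> \<not> D t False \<omega>}"

text \<open>
  The sets of latent groups, for \<open>t \<ge> 2\<close>.  For \<open>t = 2\<close> the range of \<open>l\<close> is empty, which leaves
  exactly \<open>{(NT_1, C_2)}\<close> and \<open>{(C_1, AT_2), (NT_1, F_2)}\<close>.
\<close>

definition groups_pos :: "'a measure \<Rightarrow> 'a treatment \<Rightarrow> nat \<Rightarrow> 'a set set" where
  "groups_pos M D t =
     {(\<Inter>s\<in>{1..t-1}. NT M D s) \<inter> CO M D t} \<union>
     {(\<Inter>s\<in>{1..l-1}. NT M D s) \<inter> (\<Inter>s\<in>{l..t-1}. DF M D s) \<inter> AT M D t | l. l \<in> {2..t-1}}"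

definition groups_neg :: "'a measure \<Rightarrow> 'a treatment \<Rightarrow> nat \<Rightarrow> 'a set set" where
  "groups_neg M D t =
     {(\<Inter>s\<in>{1..t-1}. CO M D s) \<inter> AT M D t, (\<Inter>s\<in>{1..t-1}. NT M D s) \<inter> DF M D t} \<union>
     {(\<Inter>s\<in>{1..l-1}. NT M D s) \<inter> (\<Inter>s\<in>{l..t-1}. CO M D s) \<inter> AT M D t | l. l \<in> {2..t-1}}"

definition groups :: "'a measure \<Rightarrow> 'a treatment \<Rightarrow> nat \<Rightarrow> 'a set set" where
  "groups M D t = groups_pos M D t \<union> groups_neg M D t"

text \<open>The elementary conditional expectation \<open>E[X | A]\<close> given an event of positive probability.\<close>

definition cond_mean :: "'a measure \<Rightarrow> ('a \<Rightarrow> real) \<Rightarrow> 'a set \<Rightarrow> real" where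
  "cond_mean M X A = (LINT \<omega>:A|M. X \<omega>) / measure M A"

definition reduced_form ::
  "'a measure \<Rightarrow> ('a \<Rightarrow> bool) \<Rightarrow> 'a treatment \<Rightarrow> (nat \<Rightarrow> bool \<Rightarrow> 'a \<Rightarrow> real)
    \<Rightarrow> (nat \<Rightarrow> nat \<Rightarrow> bool \<Rightarrow> 'a \<Rightarrow> real) \<Rightarrow> nat \<Rightarrow> real" where
  "reduced_form M Z D Y0 Y1 t =
     cond_mean M (obs_Y Z D Y0 Y1 t) {\<omega> \<in> space M. Z \<omega>}
     - cond_mean M (obs_Y Z D Y0 Y1 t) {\<omega> \<in> space M. \<not> Z \<omega>}"

definition first_stage :: "'a measure \<Rightarrow> ('a \<Rightarrow> bool) \<Rightarrow> 'a treatment \<Rightarrow> nat \<Rightarrow> real" where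
  "first_stage M Z D t =
     cond_mean M (\<lambda>\<omega>. of_bool (obs_D Z D t \<omega>)) {\<omega> \<in> space M. Z \<omega>}
     - cond_mean M (\<lambda>\<omega>. of_bool (obs_D Z D t \<omega>)) {\<omega> \<in> space M. \<not> Z \<omega>}"

definition rho :: "'a measure \<Rightarrow> ('a \<Rightarrow> bool) \<Rightarrow> 'a treatment \<Rightarrow> nat \<Rightarrow> real" where
  "rho M Z D t =
     cond_prob M (\<lambda>\<omega>. obs_D Z D t \<omega> > obs_D Z D (t - 1) \<omega>) (\<lambda>\<omega>. \<not> Z \<omega>)
     - cond_prob M (\<lambda>\<omega>. obs_D Z D t \<omega> > obs_D Z D (t - 1) \<omega>) Z"

definition causal_effect ::
  "'a measure \<Rightarrow> (nat \<Rightarrow> 'a \<Rightarrow> real) \<Rightarrow> (nat \<Rightarrow> nat \<Rightarrow> 'a \<Rightarrow> real) \<Rightarrow> nat \<Rightarrow> nat \<Rightarrow> 'a set \<Rightarrow> real" where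
  "causal_effect M Y0x Y1x t \<tau> g = cond_mean M (\<lambda>\<omega>. Y1x t \<tau> \<omega> - Y0x t \<omega>) g"

text \<open>
  The random vector \<open>(Y_t(0), Y_t(1, 0), \<dots>, Y_t(1, t-1), D_1(1), D_1(0), \<dots>, D_t(1), D_t(0))\<close>
  and its value space.
\<close>

definition potential_space :: "nat \<Rightarrow> (real \<times> (nat \<Rightarrow> real) \<times> (nat \<times> bool \<Rightarrow> bool)) measure" where
  "potential_space t =
     borel \<Otimes>\<^sub>M (\<Pi>\<^sub>M \<tau>\<in>{..<t}. borel) \<Otimes>\<^sub>M (\<Pi>\<^sub>M p\<in>{1..t} \<times> UNIV. count_space UNIV)"

definition potential_vector ::
  "'a treatment \<Rightarrow> (nat \<Rightarrow> 'a \<Rightarrow> real) \<Rightarrow> (nat \<Rightarrow> nat \<Rightarrow> 'a \<Rightarrow> real) \<Rightarrow> nat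
    \<Rightarrow> 'a \<Rightarrow> real \<times> (nat \<Rightarrow> real) \<times> (nat \<times> bool \<Rightarrow> bool)" where
  "potential_vector D Y0x Y1x t \<omega> =
     (Y0x t \<omega>, (\<lambda>\<tau>\<in>{..<t}. Y1x t \<tau> \<omega>), (\<lambda>(s, z)\<in>{1..t} \<times> UNIV. D s z \<omega>))"

text \<open>
  Independence of two random variables with different value types (the library's \<open>indep_var\<close>
  needs a common one): the sigma-algebras they generate are independent.  The \<open>indep_set\<close> predicate
  includes that both consist of events, i.e. that \<open>X\<close> and \<open>X'\<close> are measurable.
\<close>

definition indep_rv ::
  "'a measure \<Rightarrow> 'b measure \<Rightarrow> ('a \<Rightarrow> 'b) \<Rightarrow> 'c measure \<Rightarrow> ('a \<Rightarrow> 'c) \<Rightarrow> bool" where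
  "indep_rv M N X N' X' \<longleftrightarrow>
     prob_space.indep_set M (sets (vimage_algebra (space M) X N))
       (sets (vimage_algebra (space M) X' N'))"

text \<open>
  Matrix and vector indices of \<open>Jordan_Normal_Form\<close> start at 0, so row \<open>i\<close> and column \<open>j\<close> below
  belong to periods \<open>t = i + 1\<close> and \<open>s = j + 1\<close>; in particular \<open>t - s + 1 = i - j + 1\<close>.
\<close>

definition P_mat :: "'a measure \<Rightarrow> ('a \<Rightarrow> bool) \<Rightarrow> 'a treatment \<Rightarrow> nat \<Rightarrow> real mat" where
  "P_mat M Z D T = Matrix.mat T T
     (\<lambda>(i, j). if j < i then - rho M Z D (i - j + 1)
               else if j = i then first_stage M Z D 1 else 0)"

definition RF_vec ::
  "'a measure \<Rightarrow> ('a \<Rightarrow> bool) \<Rightarrow> 'a treatment \<Rightarrow> (nat \<Rightarrow> bool \<Rightarrow> 'a \<Rightarrow> real)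
    \<Rightarrow> (nat \<Rightarrow> nat \<Rightarrow> bool \<Rightarrow> 'a \<Rightarrow> real) \<Rightarrow> nat \<Rightarrow> real Matrix.vec" where
  "RF_vec M Z D Y0 Y1 T = Matrix.vec T (\<lambda>i. reduced_form M Z D Y0 Y1 (i + 1))"

end

theory Submission
  imports Defs "Jordan_Normal_Form.Determinant"
begin

text \<open>
  Let \<open>A_s(z)\<close> be the event that treatment starts in period \<open>s\<close> under instrument value \<open>z\<close>. Given
  \<open>Z = z\<close>, the outcome at \<open>t\<close> is \<open>Y_t(0)\<close> plus, on \<open>A_s(z)\<close> for \<open>s \<le> t\<close>, the gain
  \<open>Y_t(1, t-s) - Y_t(0)\<close>. By independence \<open>RF_t\<close> is therefore the sum over \<open>s \<le> t\<close> of the difference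
  between the integrals of this gain over \<open>A_s(1)\<close> and over \<open>A_s(0)\<close>. Irreversibility is inherited by
  the potential treatments, and so, up to null sets, \<open>A_s(1) - A_s(0)\<close> and \<open>A_s(0) - A_s(1)\<close> are
  disjoint unions of the latent groups of \<open>s\<close> (of \<open>C_1\<close> and \<open>F_1\<close> if \<open>s = 1\<close>). Homogeneity turns the
  \<open>s\<close>-th difference into \<open>\<Delta> (t - s)\<close> times \<open>P(A_s(1)) - P(A_s(0))\<close>, which is \<open>FS_1\<close> for \<open>s = 1\<close>
  and \<open>-\<rho>_s\<close> otherwise.
\<close>

section \<open>Independence of random variables with different value types\<close>

lemma (in prob_space) indep_rvD:
  assumes "indep_rv M N X N' X'" "A \<in> sets N" "B \<in> sets N'"
  shows "prob ((X -` A \<inter> space M) \<inter> (X' -` B \<inter> space M))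
    = prob (X -` A \<inter> space M) * prob (X' -` B \<inter> space M)"
  using assms unfolding indep_rv_def
  by (intro indep_setD) (auto intro: in_vimage_algebra)

text \<open>\<open>indep_set\<close> already makes every preimage an event; mapping into the space
  of \<open>N\<close> is the other half of measurability.\<close>

lemma (in prob_space) indep_rv_measurable:
  assumes "indep_rv M N X N' X'" "X \<in> space M \<rightarrow> space N"
  shows "X \<in> measurable M N"
proof (rule measurableI)
  fix A assume "A \<in> sets N"
  then have "X -` A \<inter> space M \<in> sets (vimage_algebra (space M) X N)"
    by (rule in_vimage_algebra)
  then show "X -` A \<inter> space M \<in> sets M"
    using assms(1) unfolding indep_rv_def indep_set_def indep_sets_def
    by (auto split: bool.splits)
qed (use assms in auto)

text \<open>Functions of independent variables are independent. Once \<open>f\<close> and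
  \<open>g\<close> land in a common type, \<open>indep_var\<close> applies and with it the product
  rule for expectations.\<close>

lemma (in prob_space) indep_rv_imp_indep_var:
  assumes ind: "indep_rv M N X N' X'"
    and X: "X \<in> measurable M N" and X': "X' \<in> measurable M N'"
    and f [measurable]: "f \<in> measurable N S" and g [measurable]: "g \<in> measurable N' S'"
  shows "indep_var S (\<lambda>\<omega>. f (X \<omega>)) S' (\<lambda>\<omega>. g (X' \<omega>))"
proof -
  note [measurable] = X X'
  \<comment> \<open>\<open>V\<close> is measurable with respect to the sigma-algebra it generates,
    hence so is its composition with \<open>h\<close>, which therefore generates a smaller
    sigma-algebra.\<close>
  have sub: "sigma_sets (space M) {(\<lambda>\<omega>. h (V \<omega>)) -` A \<inter> space M |A. A \<in> sets K}
      \<subseteq> sets (vimage_algebra (space M) V L)"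
    if h: "h \<in> measurable L K" and V: "V \<in> measurable M L" for h :: "'x \<Rightarrow> 'y" and V L K
  proof -
    have "V \<in> measurable (vimage_algebra (space M) V L) L"
      using V by (intro measurable_vimage_algebra1) (auto dest: measurable_space)
    then have "(\<lambda>\<omega>. h (V \<omega>)) \<in> measurable (vimage_algebra (space M) V L) K"
      using h by (rule measurable_compose)
    then have "{(\<lambda>\<omega>. h (V \<omega>)) -` A \<inter> space M |A. A \<in> sets K} \<subseteq> sets (vimage_algebra (space M) V L)"
      by (auto dest: measurable_sets)
    then show ?thesis
      using sets.sigma_sets_subset[of _ "vimage_algebra (space M) V L"] by simp
  qed
  have "indep_set (sigma_sets (space M) {(\<lambda>\<omega>. f (X \<omega>)) -` A \<inter> space M |A. A \<in> sets S})
     (sigma_sets (space M) {(\<lambda>\<omega>. g (X' \<omega>)) -` A \<inter> space M |A. A \<in> sets S'})"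
    unfolding indep_set_def
    by (rule indep_sets_mono_sets[OF ind[unfolded indep_rv_def indep_set_def]])
       (use sub[OF f X] sub[OF g X'] in \<open>simp split: bool.splits\<close>)
  then show ?thesis
    unfolding indep_var_eq by auto
qed

section \<open>Treatment starts and the observed outcome\<close>

text \<open>Formulated for potential statuses under a fixed instrument value, so that start events
  are functions of the vector that is independent of \<open>Z\<close>. Earlier periods are counted
  from 1 because period 0 carries no meaning.\<close>

definition starts :: "'a treatment \<Rightarrow> nat \<Rightarrow> bool \<Rightarrow> 'a \<Rightarrow> bool" where
  "starts D s z \<omega> \<longleftrightarrow> D s z \<omega> \<and> (\<forall>r\<in>{1..<s}. \<not> D r z \<omega>)"

lemma starts_unique: "starts D s z \<omega> \<Longrightarrow> starts D r z \<omega> \<Longrightarrow> 1 \<le> s \<Longrightarrow> 1 \<le> r \<Longrightarrow> s = r"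
  by (cases s r rule: linorder_cases) (auto simp: starts_def)

text \<open>At most one summand survives, the one at the first treated period. The case distinction
  in \<open>obs_Y\<close> becomes an expression that is linear in the start indicators and can be
  integrated term by term.\<close>

lemma obs_Y_eq_sum_starts:
  assumes z: "Z \<omega> = z"
  shows "obs_Y Z D Y0 Y1 t \<omega> =
    Y0 t z \<omega> + (\<Sum>s\<in>{1..t}. of_bool (starts D s z \<omega>) * (Y1 t (t - s) z \<omega> - Y0 t z \<omega>))"
proof (cases "\<exists>s\<in>{1..t}. D s z \<omega>")
  case True
  \<comment> \<open>With \<open>Z \<omega> = z\<close> this is the number that
    \<open>first_treated\<close> computes.\<close>
  define k where "k = (LEAST s. 1 \<le> s \<and> D s z \<omega>)"
  obtain s0 where s0: "s0 \<in> {1..t}" "D s0 z \<omega>"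
    using True by auto
  have k: "1 \<le> k" "D k z \<omega>"
    using LeastI[of "\<lambda>s. 1 \<le> s \<and> D s z \<omega>" s0] s0 by (auto simp: k_def)
  have kt: "k \<in> {1..t}"
    using Least_le[of "\<lambda>s. 1 \<le> s \<and> D s z \<omega>" s0] s0 k by (auto simp: k_def)
  have kmin: "\<not> D r z \<omega>" if "r \<in> {1..<k}" for r
    using not_less_Least[of r "\<lambda>s. 1 \<le> s \<and> D s z \<omega>"] that by (auto simp: k_def)
  have st: "starts D k z \<omega>"
    using k kmin by (auto simp: starts_def)
  have "(\<Sum>s\<in>{1..t}. of_bool (starts D s z \<omega>) * (Y1 t (t - s) z \<omega> - Y0 t z \<omega>))
      = (\<Sum>s\<in>{1..t}. if s = k then Y1 t (t - k) z \<omega> - Y0 t z \<omega> else 0)"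
  proof (intro sum.cong refl)
    fix s assume "s \<in> {1..t}"
    then have "starts D s z \<omega> \<longleftrightarrow> s = k"
      using st starts_unique[OF _ st _ k(1), of s] by auto
    then show "of_bool (starts D s z \<omega>) * (Y1 t (t - s) z \<omega> - Y0 t z \<omega>)
        = (if s = k then Y1 t (t - k) z \<omega> - Y0 t z \<omega> else 0)"
      by simp
  qed
  also have "\<dots> = Y1 t (t - k) z \<omega> - Y0 t z \<omega>"
    using kt by simp
  finally show ?thesis
    using True z by (simp add: obs_Y_def obs_D_def first_treated_def k_def)
next
  case False
  then show ?thesis
    using z by (simp add: obs_Y_def obs_D_def starts_def)
qed

section \<open>The law of the observation, with its two instrument arms\<close>

text \<open>Relevance and homogeneity are kept for the final theorem; homogeneity reaches the lemmas
  on start contrasts through their premise \<open>mean\<close>.\<close>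

locale iv_panel = prob_space M
  for M :: "'a measure" +
  fixes T :: nat and Z :: "'a \<Rightarrow> bool" and D :: "'a treatment"
    and Y0 :: "nat \<Rightarrow> bool \<Rightarrow> 'a \<Rightarrow> real" and Y1 :: "nat \<Rightarrow> nat \<Rightarrow> bool \<Rightarrow> 'a \<Rightarrow> real"
    and Y0x :: "nat \<Rightarrow> 'a \<Rightarrow> real" and Y1x :: "nat \<Rightarrow> nat \<Rightarrow> 'a \<Rightarrow> real"
  assumes Z_meas [measurable]: "Z \<in> measurable M (count_space UNIV)"
    and Z_nondeg: "0 < measure M {\<omega> \<in> space M. Z \<omega>}" "measure M {\<omega> \<in> space M. Z \<omega>} < 1"
    and D_meas: "\<And>t z. t \<in> {1..T} \<Longrightarrow> D t z \<in> measurable M (count_space UNIV)"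
    and Y0_int: "\<And>t z. t \<in> {1..T} \<Longrightarrow> integrable M (Y0 t z)"
    and Y1_int: "\<And>t \<tau> z. t \<in> {1..T} \<Longrightarrow> \<tau> \<in> {..<t} \<Longrightarrow> integrable M (Y1 t \<tau> z)"
    and irreversible:
      "\<And>t. t \<in> {1..T} - {T} \<Longrightarrow> AE \<omega> in M. obs_D Z D t \<omega> \<longrightarrow> obs_D Z D (t + 1) \<omega>"
    and exclusion0: "\<And>t z. t \<in> {1..T} \<Longrightarrow> AE \<omega> in M. Y0 t z \<omega> = Y0x t \<omega>"
    and exclusion1:
      "\<And>t \<tau> z. t \<in> {1..T} \<Longrightarrow> \<tau> \<in> {..<t} \<Longrightarrow> AE \<omega> in M. Y1 t \<tau> z \<omega> = Y1x t \<tau> \<omega>"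
    and independence:
      "\<And>t. t \<in> {1..T} \<Longrightarrow>
         indep_rv M (potential_space t) (potential_vector D Y0x Y1x t) (count_space UNIV) Z"
    and monotonicity: "measure M (DF M D 1) = 0"
begin

abbreviation arm :: "bool \<Rightarrow> 'a set" where
  "arm z \<equiv> {\<omega> \<in> space M. Z \<omega> = z}"

abbreviation start_event :: "nat \<Rightarrow> bool \<Rightarrow> 'a set" where
  "start_event s z \<equiv> {\<omega> \<in> space M. starts D s z \<omega>}"

abbreviation gain :: "nat \<Rightarrow> nat \<Rightarrow> 'a \<Rightarrow> real" where
  "gain t \<tau> \<omega> \<equiv> Y1x t \<tau> \<omega> - Y0x t \<omega>"

lemma prob_arm_pos: "0 < prob (arm z)"
proof (cases z)
  case True
  then show ?thesis using Z_nondeg by simp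
next
  case False
  have "prob {\<omega> \<in> space M. \<not> Z \<omega>} = 1 - prob {\<omega> \<in> space M. Z \<omega>}"
    by (rule prob_neg) simp
  then show ?thesis using Z_nondeg False by simp
qed

section \<open>Measurability and integrability of the potential outcomes without an instrument
  index\<close>

lemma potential_vector_measurable:
  assumes "t \<in> {1..T}"
  shows "potential_vector D Y0x Y1x t \<in> measurable M (potential_space t)"
  using indep_rv_measurable[OF independence[OF assms]]
  by (auto simp: potential_vector_def potential_space_def space_pair_measure space_PiM)

lemma Y0x_measurable:
  assumes t: "t \<in> {1..T}"
  shows "Y0x t \<in> borel_measurable M"
proof -
  have "(\<lambda>\<omega>. fst (potential_vector D Y0x Y1x t \<omega>)) \<in> borel_measurable M"
    using potential_vector_measurable[OF t] unfolding potential_space_def by measurable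
  then show ?thesis by (simp add: potential_vector_def)
qed

lemma Y1x_measurable:
  assumes t: "t \<in> {1..T}" and \<tau>: "\<tau> \<in> {..<t}"
  shows "Y1x t \<tau> \<in> borel_measurable M"
proof -
  have "(\<lambda>\<omega>. fst (snd (potential_vector D Y0x Y1x t \<omega>)) \<tau>) \<in> borel_measurable M"
    using potential_vector_measurable[OF t] \<tau> unfolding potential_space_def by measurable
  then show ?thesis using \<tau> by (simp add: potential_vector_def)
qed

text \<open>Integrability passes from \<open>Y0\<close> along the a.e. equality of exclusion. Such
  an equality does not give measurability on a space that may be incomplete; this comes from the
  independence assumption.\<close>

lemma Y0x_integrable:
  assumes t: "t \<in> {1..T}"
  shows "integrable M (Y0x t)"
  using integrable_cong_AE_imp[OF Y0_int[OF t, of True] Y0x_measurable[OF t]]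
    exclusion0[OF t, of True] by (simp add: eq_commute)

lemma Y1x_integrable:
  assumes t: "t \<in> {1..T}" and \<tau>: "\<tau> \<in> {..<t}"
  shows "integrable M (Y1x t \<tau>)"
  using integrable_cong_AE_imp[OF Y1_int[OF t \<tau>, of True] Y1x_measurable[OF t \<tau>]]
    exclusion1[OF t \<tau>, of True] by (simp add: eq_commute)

lemma gain_integrable:
  assumes "t \<in> {1..T}" "\<tau> \<in> {..<t}"
  shows "integrable M (gain t \<tau>)"
  using assms by (intro Bochner_Integration.integrable_diff Y0x_integrable Y1x_integrable)

lemma starts_measurable:
  assumes s: "s \<in> {1..T}"
  shows "Measurable.pred M (starts D s z)"
proof -
  have [measurable]: "Measurable.pred M (D r z)" if "r \<in> {1..s}" for r
    using D_meas[of r z] that s by auto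
  show ?thesis
    unfolding starts_def
    by (intro pred_intros_logic pred_intros_finite) (use s D_meas in auto)
qed

lemma start_event_sets: "s \<in> {1..T} \<Longrightarrow> start_event s z \<in> events"
  using starts_measurable[of s z] by simp

section \<open>Factorization over the instrument arms\<close>

lemma prob_potential_arm:
  assumes t: "t \<in> {1..T}" and P: "Measurable.pred (potential_space t) P"
  shows "prob {\<omega> \<in> space M. P (potential_vector D Y0x Y1x t \<omega>) \<and> Z \<omega> = z}
    = prob {\<omega> \<in> space M. P (potential_vector D Y0x Y1x t \<omega>)} * prob (arm z)"
proof -
  let ?V = "potential_vector D Y0x Y1x t"
  let ?A = "{v \<in> space (potential_space t). P v}"
  have A: "?A \<in> sets (potential_space t)"
    using P by simp
  have "?V -` ?A \<inter> space M = {\<omega> \<in> space M. P (?V \<omega>)}"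
    using measurable_space[OF potential_vector_measurable[OF t]] by auto
  moreover have "Z -` {z} \<inter> space M = arm z"
    by auto
  moreover have "{\<omega> \<in> space M. P (?V \<omega>)} \<inter> arm z = {\<omega> \<in> space M. P (?V \<omega>) \<and> Z \<omega> = z}"
    by auto
  ultimately show ?thesis
    using indep_rvD[OF independence[OF t] A, of "{z}"] by simp
qed

lemma prob_treatment_arm:
  assumes t: "t \<in> {1..T}" and P: "Measurable.pred (\<Pi>\<^sub>M p\<in>{1..t} \<times> UNIV. count_space UNIV) P"
  shows "prob {\<omega> \<in> space M. P (\<lambda>(s, z)\<in>{1..t} \<times> UNIV. D s z \<omega>) \<and> Z \<omega> = z}
    = prob {\<omega> \<in> space M. P (\<lambda>(s, z)\<in>{1..t} \<times> UNIV. D s z \<omega>)} * prob (arm z)"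
proof -
  note P[measurable]
  have "Measurable.pred (potential_space t) (\<lambda>v. P (snd (snd v)))"
    unfolding potential_space_def by measurable
  from prob_potential_arm[OF t this] show ?thesis
    by (simp add: potential_vector_def)
qed

text \<open>Restricting to an arm is multiplying by the indicator of \<open>Z = z\<close>, which is
  independent of any function of the potential vector.\<close>

lemma integral_potential_arm:
  assumes t: "t \<in> {1..T}" and f: "f \<in> borel_measurable (potential_space t)"
    and int: "integrable M (\<lambda>\<omega>. f (potential_vector D Y0x Y1x t \<omega>))"
  shows "(LINT \<omega>:arm z|M. f (potential_vector D Y0x Y1x t \<omega>))
    = prob (arm z) * expectation (\<lambda>\<omega>. f (potential_vector D Y0x Y1x t \<omega>))"
proof -
  let ?V = "potential_vector D Y0x Y1x t"
  have "indep_var borel (\<lambda>\<omega>. f (?V \<omega>)) borel (\<lambda>\<omega>. of_bool (Z \<omega> = z) :: real)"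
    by (rule indep_rv_imp_indep_var[OF independence[OF t] potential_vector_measurable[OF t] Z_meas f])
       simp
  moreover have "integrable M (\<lambda>\<omega>. of_bool (Z \<omega> = z) :: real)"
    by (rule integrable_const_bound[of _ 1]) auto
  ultimately have "expectation (\<lambda>\<omega>. f (?V \<omega>) * of_bool (Z \<omega> = z))
      = expectation (\<lambda>\<omega>. f (?V \<omega>)) * expectation (\<lambda>\<omega>. of_bool (Z \<omega> = z))"
    using int by (intro indep_var_lebesgue_integral)
  moreover have "expectation (\<lambda>\<omega>. of_bool (Z \<omega> = z)) = prob (arm z)"
  proof -
    have "expectation (\<lambda>\<omega>. of_bool (Z \<omega> = z) :: real) = expectation (indicator (arm z))"
      by (intro Bochner_Integration.integral_cong) (auto simp: indicator_def)
    then show ?thesis by simp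
  qed
  moreover have "(LINT \<omega>:arm z|M. f (?V \<omega>)) = expectation (\<lambda>\<omega>. f (?V \<omega>) * of_bool (Z \<omega> = z))"
    unfolding set_lebesgue_integral_def
    by (intro Bochner_Integration.integral_cong) (auto simp: indicator_def)
  ultimately show ?thesis by simp
qed

section \<open>Irreversibility of the potential treatments\<close>

text \<open>On the arm \<open>Z = z\<close> the observed status is \<open>D t z\<close>, so a
  reversal under \<open>z\<close> has probability zero jointly with the arm. By independence that
  probability is a product, and the arm has positive probability, so reversal under \<open>z\<close>
  is null on the whole space.\<close>

lemma potential_irreversible:
  assumes t: "t \<in> {1..T} - {T}"
  shows "AE \<omega> in M. D t z \<omega> \<longrightarrow> D (t + 1) z \<omega>"
proof -
  have t': "t + 1 \<in> {1..T}" "t \<in> {1..T}"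
    using t by auto
  note [measurable] = D_meas[OF t'(1)] D_meas[OF t'(2)]
  have "AE \<omega> in M. \<not> (D t z \<omega> \<and> \<not> D (t + 1) z \<omega> \<and> Z \<omega> = z)"
    using irreversible[OF t] by eventually_elim (cases z; auto simp: obs_D_def)
  moreover have "{\<omega> \<in> space M. (D t z \<omega> \<and> \<not> D (t + 1) z \<omega>) \<and> Z \<omega> = z} \<in> events"
    by measurable
  ultimately have "prob {\<omega> \<in> space M. (D t z \<omega> \<and> \<not> D (t + 1) z \<omega>) \<and> Z \<omega> = z} = 0"
    by (subst prob_eq_0) auto
  moreover have "Measurable.pred (\<Pi>\<^sub>M p\<in>{1..t+1} \<times> UNIV. count_space UNIV)
      (\<lambda>d :: nat \<times> bool \<Rightarrow> bool. d (t, z) \<and> \<not> d (t + 1, z))"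
    by (measurable; use t in auto)
  note prob_treatment_arm[OF t'(1) this, of z]
  ultimately have "prob {\<omega> \<in> space M. D t z \<omega> \<and> \<not> D (t + 1) z \<omega>} = 0"
    using prob_arm_pos[of z] t by simp
  moreover have "{\<omega> \<in> space M. D t z \<omega> \<and> \<not> D (t + 1) z \<omega>} \<in> events"
    by measurable
  ultimately have "AE \<omega> in M. \<not> (D t z \<omega> \<and> \<not> D (t + 1) z \<omega>)"
    by (subst (asm) prob_eq_0) auto
  then show ?thesis by eventually_elim auto
qed

lemma potential_irreversible_all:
  "AE \<omega> in M. \<forall>z. \<forall>r s. 1 \<le> r \<longrightarrow> r \<le> s \<longrightarrow> s \<le> T \<longrightarrow> D r z \<omega> \<longrightarrow> D s z \<omega>"
proof -
  have "AE \<omega> in M. \<forall>t\<in>{1..T}-{T}. \<forall>z\<in>UNIV. D t z \<omega> \<longrightarrow> D (t + 1) z \<omega>"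
    by (intro AE_finite_allI potential_irreversible) auto
  then show ?thesis
  proof eventually_elim
    case (elim \<omega>)
    have "D s z \<omega>" if "r \<le> s" "1 \<le> r" "s \<le> T" "D r z \<omega>" for z r s
      using that by (induction s rule: dec_induct) (use elim in auto)
    then show ?case by blast
  qed
qed

section \<open>First stage and \<open>rho\<close> as contrasts of start probabilities\<close>

lemma first_stage_1:
  assumes "1 \<le> T"
  shows "first_stage M Z D 1 = prob (start_event 1 True) - prob (start_event 1 False)"
proof -
  have t: "1 \<in> {1..T}"
    using assms by simp
  have [measurable]: "Measurable.pred M (D (Suc 0) z)" for z
    using D_meas[OF t] by simp
  have "cond_mean M (\<lambda>\<omega>. of_bool (obs_D Z D 1 \<omega>)) (arm z) = prob (start_event 1 z)" for z
  proof -
    have "Measurable.pred (\<Pi>\<^sub>M p\<in>{1..1} \<times> UNIV. count_space UNIV) (\<lambda>d :: nat \<times> bool \<Rightarrow> bool. d (1, z))"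
      by (measurable; auto)
    from prob_treatment_arm[OF t this, of z]
    have "prob {\<omega> \<in> space M. D 1 z \<omega> \<and> Z \<omega> = z} = prob {\<omega> \<in> space M. D 1 z \<omega>} * prob (arm z)"
      by simp
    moreover have "(LINT \<omega>:arm z|M. of_bool (obs_D Z D 1 \<omega>) :: real) =
        expectation (indicator {\<omega> \<in> space M. D 1 z \<omega> \<and> Z \<omega> = z})"
      unfolding set_lebesgue_integral_def
      by (intro Bochner_Integration.integral_cong; cases z) (auto simp: indicator_def obs_D_def)
    ultimately show ?thesis
      using prob_arm_pos[of z] by (simp add: cond_mean_def starts_def)
  qed
  from this[of True] this[of False] show ?thesis
    by (simp add: first_stage_def)
qed

text \<open>By irreversibility, being untreated at \<open>s - 1\<close> means a.e. being untreated
  in all periods before \<open>s\<close>, so an increase at \<open>s\<close> is a start at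
  \<open>s\<close>. Independence removes the conditioning on \<open>Z\<close>. The minus sign
  appears because \<open>rho\<close> subtracts the arm \<open>Z = 1\<close> from the arm
  \<open>Z = 0\<close>.\<close>

lemma rho_eq:
  assumes s: "s \<in> {2..T}"
  shows "- rho M Z D s = prob (start_event s True) - prob (start_event s False)"
proof -
  have s': "s \<in> {1..T}" "s - 1 \<in> {1..T}"
    using s by auto
  note [measurable] = D_meas[OF s'(1)] D_meas[OF s'(2)] starts_measurable[OF s'(1)]
  have "cond_prob M (\<lambda>\<omega>. obs_D Z D s \<omega> > obs_D Z D (s - 1) \<omega>) (\<lambda>\<omega>. Z \<omega> = z)
      = prob (start_event s z)" for z
  proof -
    have "AE \<omega> in M. (obs_D Z D s \<omega> > obs_D Z D (s - 1) \<omega> \<and> Z \<omega> = z)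
        \<longleftrightarrow> (starts D s z \<omega> \<and> Z \<omega> = z)"
      using potential_irreversible_all
    proof eventually_elim
      case (elim \<omega>)
      have "D s z \<omega> \<and> \<not> D (s - 1) z \<omega> \<longleftrightarrow> starts D s z \<omega>"
      proof
        assume a: "D s z \<omega> \<and> \<not> D (s - 1) z \<omega>"
        have "\<not> D r z \<omega>" if "r \<in> {1..<s}" for r
        proof -
          have "1 \<le> r" "r \<le> s - 1" "s - 1 \<le> T"
            using that s by auto
          then show ?thesis
            using elim a by blast
        qed
        then show "starts D s z \<omega>"
          using a by (auto simp: starts_def)
      qed (use s in \<open>auto simp: starts_def\<close>)
      then show ?case by (auto simp: obs_D_def)
    qed
    then have "prob {\<omega> \<in> space M. obs_D Z D s \<omega> > obs_D Z D (s - 1) \<omega> \<and> Z \<omega> = z}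
        = prob {\<omega> \<in> space M. starts D s z \<omega> \<and> Z \<omega> = z}"
    proof (intro finite_measure_eq_AE)
      have "{\<omega> \<in> space M. obs_D Z D s \<omega> > obs_D Z D (s - 1) \<omega> \<and> Z \<omega> = z}
        = {\<omega> \<in> space M. D s z \<omega> \<and> \<not> D (s - 1) z \<omega> \<and> Z \<omega> = z}"
        by (auto simp: obs_D_def)
      also have "\<dots> \<in> events"
        by measurable
      finally show "{\<omega> \<in> space M. obs_D Z D s \<omega> > obs_D Z D (s - 1) \<omega> \<and> Z \<omega> = z} \<in> events" .
    qed auto
    also have "\<dots> = prob (start_event s z) * prob (arm z)"
    proof -
      have "Measurable.pred (\<Pi>\<^sub>M p\<in>{1..s} \<times> UNIV. count_space UNIV)
          (\<lambda>d :: nat \<times> bool \<Rightarrow> bool. d (s, z) \<and> (\<forall>r\<in>{1..<s}. \<not> d (r, z)))"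
        by (intro pred_intros_logic pred_intros_finite measurable_component_singleton)
           (use s in auto)
      from prob_treatment_arm[OF s'(1) this, of z] show ?thesis
        using s by (simp add: starts_def)
    qed
    finally show ?thesis
      using prob_arm_pos[of z] by (simp add: cond_prob_def)
  qed
  from this[of True] this[of False] show ?thesis
    by (simp add: rho_def)
qed

section \<open>Decomposition of the reduced form by starting period\<close>

text \<open>On the arm, the observed outcome is a.e. a function of the potential vector: the
  untreated outcome plus the gain of whichever start event occurs. Independence then turns the
  conditional mean into an unconditional one.\<close>

lemma cond_mean_obs_Y:
  assumes t: "t \<in> {1..T}"
  shows "cond_mean M (obs_Y Z D Y0 Y1 t) (arm z)
    = expectation (Y0x t) + (\<Sum>s\<in>{1..t}. LINT \<omega>:start_event s z|M. gain t (t - s) \<omega>)"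
proof -
  let ?V = "potential_vector D Y0x Y1x t"
  \<comment> \<open>The start indicators are written through the coordinates of the vector, so that
    one use of independence covers the untreated outcome and all gains together.\<close>
  define f :: "real \<times> (nat \<Rightarrow> real) \<times> (nat \<times> bool \<Rightarrow> bool) \<Rightarrow> real" where
    "f v = fst v + (\<Sum>s\<in>{1..t}. of_bool (snd (snd v) (s, z) \<and> (\<forall>r\<in>{1..<s}. \<not> snd (snd v) (r, z)))
              * (fst (snd v) (t - s) - fst v))" for v
  have f_V: "f (?V \<omega>) = Y0x t \<omega> + (\<Sum>s\<in>{1..t}. of_bool (starts D s z \<omega>) * gain t (t - s) \<omega>)" for \<omega>
    unfolding f_def potential_vector_def starts_def
    by (auto intro!: sum.cong)
  have f_meas: "f \<in> borel_measurable (potential_space t)"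
  proof -
    have d: "Measurable.pred (potential_space t) (\<lambda>v. snd (snd v) (s, z))" if "s \<in> {1..t}" for s
    proof -
      have [measurable]: "Measurable.pred (\<Pi>\<^sub>M p\<in>{1..t} \<times> UNIV. count_space UNIV)
          (\<lambda>d :: nat \<times> bool \<Rightarrow> bool. d (s, z))"
        by (rule measurable_component_singleton) (use that in auto)
      show ?thesis
        unfolding potential_space_def by measurable
    qed
    have y1: "(\<lambda>v. fst (snd v) \<tau>) \<in> borel_measurable (potential_space t)" if "\<tau> \<in> {..<t}" for \<tau>
    proof -
      have [measurable]: "(\<lambda>y. y \<tau>) \<in> borel_measurable (\<Pi>\<^sub>M \<tau>\<in>{..<t}. borel :: real measure)"
        by (rule measurable_component_singleton[OF that])
      show ?thesis
        unfolding potential_space_def by measurable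
    qed
    have [measurable]: "fst \<in> borel_measurable (potential_space t)"
      unfolding potential_space_def by measurable
    have "(\<lambda>v. of_bool (snd (snd v) (s, z) \<and> (\<forall>r\<in>{1..<s}. \<not> snd (snd v) (r, z)))
        * (fst (snd v) (t - s) - fst v)) \<in> borel_measurable (potential_space t)"
      if s: "s \<in> {1..t}" for s
    proof -
      have [measurable]: "Measurable.pred (potential_space t)
         (\<lambda>v. snd (snd v) (s, z) \<and> (\<forall>r\<in>{1..<s}. \<not> snd (snd v) (r, z)))"
        by (intro pred_intros_logic pred_intros_finite d) (use s in auto)
      have [measurable]: "(\<lambda>v. fst (snd v) (t - s)) \<in> borel_measurable (potential_space t)"
        by (rule y1) (use s in auto)
      show ?thesis by measurable
    qed
    then show ?thesis
      unfolding f_def[abs_def] by (intro borel_measurable_add borel_measurable_sum) auto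
  qed
  have set_int: "set_integrable M (start_event s z) (gain t (t - s))" if "s \<in> {1..t}" for s
    unfolding set_integrable_def
    by (rule integrable_mult_indicator[OF start_event_sets gain_integrable]) (use that t in auto)
  have term_eq: "indicat_real (start_event s z) \<omega> *\<^sub>R gain t (t - s) \<omega>
      = of_bool (starts D s z \<omega>) * gain t (t - s) \<omega>" if "\<omega> \<in> space M" for s \<omega>
    using that by (auto simp: indicator_def)
  have eq: "f (?V \<omega>) = Y0x t \<omega> +
      (\<Sum>s\<in>{1..t}. indicat_real (start_event s z) \<omega> *\<^sub>R gain t (t - s) \<omega>)" if "\<omega> \<in> space M" for \<omega>
    unfolding f_V using that by (simp only: term_eq)
  have int_rhs: "integrable M (\<lambda>\<omega>. Y0x t \<omega> +
      (\<Sum>s\<in>{1..t}. indicat_real (start_event s z) \<omega> *\<^sub>R gain t (t - s) \<omega>))"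
    using set_int unfolding set_integrable_def
    by (intro Bochner_Integration.integrable_add Y0x_integrable Bochner_Integration.integrable_sum) (use t in auto)
  have f_int: "integrable M (\<lambda>\<omega>. f (?V \<omega>))"
    using int_rhs by (simp add: eq cong: Bochner_Integration.integrable_cong)
  have E: "expectation (\<lambda>\<omega>. f (?V \<omega>))
      = expectation (Y0x t) + (\<Sum>s\<in>{1..t}. LINT \<omega>:start_event s z|M. gain t (t - s) \<omega>)"
  proof -
    have "expectation (\<lambda>\<omega>. f (?V \<omega>)) = expectation (\<lambda>\<omega>. Y0x t \<omega> +
        (\<Sum>s\<in>{1..t}. indicat_real (start_event s z) \<omega> *\<^sub>R gain t (t - s) \<omega>))"
      by (rule Bochner_Integration.integral_cong[OF refl eq])
    also have "\<dots> = expectation (Y0x t) +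
        expectation (\<lambda>\<omega>. \<Sum>s\<in>{1..t}. indicat_real (start_event s z) \<omega> *\<^sub>R gain t (t - s) \<omega>)"
      using set_int unfolding set_integrable_def
      by (intro Bochner_Integration.integral_add Y0x_integrable t Bochner_Integration.integrable_sum)
    also have "expectation (\<lambda>\<omega>. \<Sum>s\<in>{1..t}. indicat_real (start_event s z) \<omega> *\<^sub>R gain t (t - s) \<omega>)
        = (\<Sum>s\<in>{1..t}. LINT \<omega>:start_event s z|M. gain t (t - s) \<omega>)"
      using set_int unfolding set_integrable_def set_lebesgue_integral_def
      by (rule Bochner_Integration.integral_sum)
    finally show ?thesis .
  qed
  \<comment> \<open>The observed outcome with the instrument frozen at \<open>z\<close>: it equals
    \<open>obs_Y\<close> at every point of the arm, and exclusion makes it a.e. equal to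
    \<open>f\<close> of the potential vector.\<close>
  let ?U = "\<lambda>\<omega>. Y0 t z \<omega> + (\<Sum>s\<in>{1..t}. of_bool (starts D s z \<omega>) * (Y1 t (t - s) z \<omega> - Y0 t z \<omega>))"
  have U_meas: "?U \<in> borel_measurable M"
  proof -
    have [measurable]: "Y0 t z \<in> borel_measurable M"
      using Y0_int[OF t] by (rule borel_measurable_integrable)
    have "(\<lambda>\<omega>. of_bool (starts D s z \<omega>) * (Y1 t (t - s) z \<omega> - Y0 t z \<omega>)) \<in> borel_measurable M"
      if "s \<in> {1..t}" for s
    proof -
      have [measurable]: "Y1 t (t - s) z \<in> borel_measurable M" "Measurable.pred M (starts D s z)"
        using that t by (auto intro!: borel_measurable_integrable Y1_int starts_measurable)
      show ?thesis by measurable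
    qed
    then show ?thesis
      by (intro borel_measurable_add borel_measurable_sum) auto
  qed
  have "AE \<omega> in M. \<forall>s\<in>{1..t}. Y1 t (t - s) z \<omega> = Y1x t (t - s) \<omega>"
    by (intro AE_finite_allI exclusion1) (use t in auto)
  then have U_eq: "AE \<omega> in M. ?U \<omega> = f (?V \<omega>)"
    using exclusion0[OF t, of z]
    by eventually_elim (simp add: f_V)
  have V: "?V \<in> measurable M (potential_space t)"
    by (rule potential_vector_measurable[OF t])
  have "(LINT \<omega>:arm z|M. obs_Y Z D Y0 Y1 t \<omega>) = (LINT \<omega>:arm z|M. ?U \<omega>)"
    by (intro set_lebesgue_integral_cong) (simp_all add: obs_Y_eq_sum_starts del: sum_of_bool_mult_eq)
  also have "\<dots> = (LINT \<omega>:arm z|M. f (?V \<omega>))"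
    using U_eq U_meas measurable_compose[OF V f_meas]
    by (intro set_lebesgue_integral_cong_AE) auto
  also have "\<dots> = prob (arm z) * expectation (\<lambda>\<omega>. f (?V \<omega>))"
    by (rule integral_potential_arm[OF t f_meas f_int])
  finally show ?thesis
    using prob_arm_pos[of z] by (simp add: cond_mean_def E)
qed

text \<open>The mean of \<open>Y0x t\<close> is common to both arms and cancels.\<close>

lemma reduced_form_eq:
  assumes "t \<in> {1..T}"
  shows "reduced_form M Z D Y0 Y1 t = (\<Sum>s\<in>{1..t}.
    (LINT \<omega>:start_event s True|M. gain t (t - s) \<omega>) - (LINT \<omega>:start_event s False|M. gain t (t - s) \<omega>))"
  using cond_mean_obs_Y[OF assms, of True] cond_mean_obs_Y[OF assms, of False]
  by (simp add: reduced_form_def sum_subtractf)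

end

section \<open>Integrals proportional to probabilities\<close>

lemma (in prob_space) set_integral_null_event:
  fixes X :: "'a \<Rightarrow> real"
  assumes g: "g \<in> events" and null: "prob g = 0"
  shows "(LINT \<omega>:g|M. X \<omega>) = 0"
proof -
  have "AE \<omega> in M. \<omega> \<notin> g"
    using g null by (intro AE_not_in) (auto simp: null_sets_def emeasure_eq_measure)
  then show ?thesis
    unfolding set_lebesgue_integral_def
    by (intro integral_eq_zero_AE) (auto elim!: eventually_mono simp: indicator_def)
qed

text \<open>On a null event both sides vanish, so the conditional mean has to be known only where it
  is a genuine quotient.\<close>

lemma (in prob_space) set_integral_eq_cond_mean:
  assumes "g \<in> events" and "0 < prob g \<Longrightarrow> cond_mean M X g = c"
  shows "(LINT \<omega>:g|M. X \<omega>) = c * prob g"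
proof (cases "prob g = 0")
  case True
  then show ?thesis using set_integral_null_event[OF assms(1)] by simp
next
  case False
  then show ?thesis
    using assms(2) by (auto simp: cond_mean_def zero_less_measure_iff field_simps)
qed

text \<open>Both sides are additive over disjoint events. The family is indexed by its own members,
  so groups that coincide are counted once.\<close>

lemma (in prob_space) set_integral_Union_cond_mean:
  assumes fin: "finite \<G>" and ev: "\<G> \<subseteq> events"
    and disj: "disjoint \<G>"
    and int: "integrable M X"
    and mean: "\<And>g. g \<in> \<G> \<Longrightarrow> 0 < prob g \<Longrightarrow> cond_mean M X g = c"
  shows "(LINT \<omega>:\<Union>\<G>|M. X \<omega>) = c * prob (\<Union>\<G>)"
proof -
  have fam: "disjoint_family_on (\<lambda>g. g) \<G>"
    using disj by (auto simp: disjoint_family_on_def disjoint_def)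
  have "set_integrable M g X" if "g \<in> \<G>" for g
    unfolding set_integrable_def using that ev int by (intro integrable_mult_indicator) auto
  then have "(LINT \<omega>:(\<Union>g\<in>\<G>. g)|M. X \<omega>) = (\<Sum>g\<in>\<G>. LINT \<omega>:g|M. X \<omega>)"
    using ev by (intro set_integral_finite_Union fin fam) auto
  also have "\<dots> = (\<Sum>g\<in>\<G>. c * prob g)"
    by (intro sum.cong refl set_integral_eq_cond_mean mean) (use ev in auto)
  also have "\<dots> = c * prob (\<Union>g\<in>\<G>. g)"
    using finite_measure_finite_Union[OF fin _ fam] ev by (simp add: sum_distrib_left)
  finally show ?thesis by simp
qed

text \<open>The contributions of the intersection cancel, both between the integrals and between the
  probabilities.\<close>

lemma (in prob_space) set_integral_diff_proportional:
  fixes X :: "'a \<Rightarrow> real"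
  assumes [measurable]: "A \<in> events" "B \<in> events" and int: "integrable M X"
    and AB: "(LINT \<omega>:A - B|M. X \<omega>) = c * prob (A - B)"
    and BA: "(LINT \<omega>:B - A|M. X \<omega>) = c * prob (B - A)"
  shows "(LINT \<omega>:A|M. X \<omega>) - (LINT \<omega>:B|M. X \<omega>) = c * (prob A - prob B)"
proof -
  have set_int: "set_integrable M S X" if "S \<in> events" for S
    using that int unfolding set_integrable_def by (rule integrable_mult_indicator)
  have split: "(LINT \<omega>:S|M. X \<omega>) = (LINT \<omega>:S - R|M. X \<omega>) + (LINT \<omega>:S \<inter> R|M. X \<omega>)
      \<and> prob S = prob (S - R) + prob (S \<inter> R)" if "S \<in> events" "R \<in> events" for S R
  proof -
    have "(S - R) \<union> (S \<inter> R) = S" "(S - R) \<inter> (S \<inter> R) = {}"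
      by auto
    then show ?thesis
      using set_integral_Un[of "S - R" "S \<inter> R" M X] finite_measure_Union[of "S - R" "S \<inter> R"]
        set_int that by auto
  qed
  show ?thesis
    using split[of A B] split[of B A] AB BA by (simp add: Int_commute algebra_simps)
qed

section \<open>Disjointness of the latent groups\<close>

text \<open>For \<open>l < k\<close>, period \<open>l\<close> separates the two members: it lies in
  the \<open>B\<close> range of the first and in the \<open>A\<close> range of the second. The extra
  set \<open>H\<close> is separated from all of them by \<open>C\<close>.\<close>

lemma disjoint_tail_groups:
  fixes A B :: "nat \<Rightarrow> 'b set"
  assumes L: "L \<subseteq> {1..n}" and AB: "\<And>r. A r \<inter> B r = {}" and HC: "H \<inter> C = {}"
  shows "disjoint (insert H {(\<Inter>r\<in>{1..l-1}. A r) \<inter> (\<Inter>r\<in>{l..n}. B r) \<inter> C |l. l \<in> L})"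
proof -
  define g where "g l = (\<Inter>r\<in>{1..l-1}. A r) \<inter> (\<Inter>r\<in>{l..n}. B r) \<inter> C" for l
  have less: "g l \<inter> g k = {}" if "l \<in> L" "l < k" for l k
  proof -
    have "l \<in> {1..k-1}" "l \<in> {l..n}"
      using L that by auto
    then have "g l \<inter> g k \<subseteq> A l \<inter> B l"
      unfolding g_def by blast
    then show ?thesis using AB by blast
  qed
  have "g l \<inter> g k = {}" if "l \<in> L" "k \<in> L" "g l \<noteq> g k" for l k
    using less[of l k] less[of k l] that by (cases l k rule: linorder_cases) auto
  moreover have "H \<inter> g l = {}" "g l \<inter> H = {}" for l
    using HC by (auto simp: g_def)
  ultimately have "a \<inter> b = {}"
    if "a \<in> insert H {g l |l. l \<in> L}" "b \<in> insert H {g l |l. l \<in> L}" "a \<noteq> b" for a b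
    using that by (elim insertE CollectE exE conjE) simp_all
  then have "disjoint (insert H {g l |l. l \<in> L})"
    by (rule disjointI)
  then show ?thesis by (simp only: g_def)
qed

lemma disjoint_groups_pos: "disjoint (groups_pos M D t)"
  unfolding groups_pos_def insert_is_Un[symmetric]
proof (rule disjoint_tail_groups)
  show "{2..t-1} \<subseteq> {1..t-1}" "NT M D r \<inter> DF M D r = {}"
    "(\<Inter>s\<in>{1..t-1}. NT M D s) \<inter> CO M D t \<inter> AT M D t = {}" for r
    by (auto simp: NT_def DF_def CO_def AT_def)
qed

lemma disjoint_groups_neg:
  assumes "2 \<le> t"
  shows "disjoint (groups_neg M D t)"
proof -
  let ?g = "\<lambda>l. (\<Inter>s\<in>{1..l-1}. NT M D s) \<inter> (\<Inter>s\<in>{l..t-1}. CO M D s) \<inter> AT M D t"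
  let ?H = "(\<Inter>s\<in>{1..t-1}. NT M D s) \<inter> DF M D t"
  have l1: "{1..t-1} = insert 1 {2..t-1}"
    using assms by auto
  have F: "{f l |l. l \<in> {1..t-1}} = insert (f 1) {f l |l. l \<in> {2..t-1}}" for f :: "nat \<Rightarrow> 'a set"
    unfolding l1 by blast

  \<comment> \<open>The group \<open>(C_{1:t-1}, AT_t)\<close> is the case \<open>l = 1\<close> of the family with \<open>l \<ge> 2\<close>.\<close>
  have eq: "groups_neg M D t = insert ?H {?g l |l. l \<in> {1..t-1}}"
    unfolding groups_neg_def F[of ?g] by (simp add: insert_commute)
  show ?thesis
    unfolding eq
    by (rule disjoint_tail_groups) (auto simp: NT_def CO_def DF_def AT_def)
qed

lemma finite_groups: "finite (groups M D t)"
  by (simp add: groups_def groups_pos_def groups_neg_def)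

section \<open>Differences of start events as unions of latent groups\<close>

text \<open>If treatment starts at \<open>s\<close> under \<open>z\<close> but not under
  \<open>z'\<close>, then under \<open>z'\<close> it has either not started by \<open>s\<close> or
  started at some earlier \<open>l\<close> and persisted. The orientation is left open:
  \<open>z = True\<close> serves the groups in \<open>groups_pos\<close>, \<open>z = False\<close>
  those in \<open>groups_neg\<close>.\<close>

lemma starts_difference_iff:
  assumes mono: "\<And>y q r. 1 \<le> q \<Longrightarrow> q \<le> r \<Longrightarrow> r \<le> s \<Longrightarrow> D q y \<omega> \<Longrightarrow> D r y \<omega>"
    and z': "z' = (\<not> z)"
  shows "starts D s z \<omega> \<and> \<not> starts D s z' \<omega> \<longleftrightarrow>
    ((\<forall>r\<in>{1..s-1}. \<not> D r z \<omega> \<and> \<not> D r z' \<omega>) \<and> D s z \<omega> \<and> \<not> D s z' \<omega>) \<or>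
    (\<exists>l\<in>{1..s-1}. (\<forall>r\<in>{1..l-1}. \<not> D r z \<omega> \<and> \<not> D r z' \<omega>) \<and>
      (\<forall>r\<in>{l..s-1}. \<not> D r z \<omega> \<and> D r z' \<omega>) \<and> D s z \<omega> \<and> D s z' \<omega>)"
    (is "?L \<longleftrightarrow> ?R1 \<or> (\<exists>l\<in>_. ?R2 l)")
proof
  assume L: ?L
  show "?R1 \<or> (\<exists>l\<in>{1..s-1}. ?R2 l)"
  proof (cases "\<exists>r\<in>{1..s-1}. D r z' \<omega>")
    case True
    \<comment> \<open>The period of the first treatment under \<open>z'\<close>.\<close>
    define l where "l = (LEAST r. 1 \<le> r \<and> D r z' \<omega>)"
    obtain r0 where r0: "r0 \<in> {1..s-1}" "D r0 z' \<omega>"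
      using True by auto
    have l: "1 \<le> l" "D l z' \<omega>" "l \<le> r0"
      using LeastI[of "\<lambda>r. 1 \<le> r \<and> D r z' \<omega>" r0] Least_le[of "\<lambda>r. 1 \<le> r \<and> D r z' \<omega>" r0] r0
      by (auto simp: l_def)
    have before: "\<not> D r z' \<omega>" if "r \<in> {1..l-1}" for r
    proof -
      have "r < l" using that l(1) by auto
      then show ?thesis
        using not_less_Least[of r "\<lambda>r. 1 \<le> r \<and> D r z' \<omega>"] that by (auto simp: l_def)
    qed
    \<comment> \<open>The range includes \<open>s\<close> itself, which makes the unit always
      treated there.\<close>
    have after: "D r z' \<omega>" if "r \<in> {l..s}" for r
      using mono[of l r z'] l that by auto
    have "?R2 l"
      using L before after l r0 by (auto simp: starts_def)
    then show ?thesis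
      using l r0 by auto
  next
    case False
    then show ?thesis
      using L by (auto simp: starts_def)
  qed
next
  assume "?R1 \<or> (\<exists>l\<in>{1..s-1}. ?R2 l)"
  then show ?L
  proof
    assume ?R1
    then show ?L by (auto simp: starts_def)
  next
    assume "\<exists>l\<in>{1..s-1}. ?R2 l"
    then obtain l where l: "l \<in> {1..s-1}" "?R2 l" by blast
    have "\<not> D r z \<omega>" if "r \<in> {1..<s}" for r
      using that l by (cases "r < l") auto
    moreover have "D l z' \<omega>" "l \<in> {1..<s}"
      using l by auto
    ultimately show ?L
      using l unfolding starts_def by blast
  qed
qed

lemma mem_Union_groups:
  "x \<in> \<Union>(\<H> \<union> {f l |l. l \<in> I}) \<longleftrightarrow> (\<exists>h\<in>\<H>. x \<in> h) \<or> (\<exists>l\<in>I. x \<in> f l)"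
  by blast

text \<open>The case \<open>l = 1\<close> of \<open>starts_difference_iff\<close> would make
  \<omega> a defier in period 1, which is excluded; the remaining cases are the listed
  groups.\<close>

lemma mem_groups_pos_iff:
  assumes \<omega>: "\<omega> \<in> space M" "\<omega> \<notin> DF M D 1" and s: "2 \<le> s"
    and mono: "\<And>y q r. 1 \<le> q \<Longrightarrow> q \<le> r \<Longrightarrow> r \<le> s \<Longrightarrow> D q y \<omega> \<Longrightarrow> D r y \<omega>"
  shows "\<omega> \<in> \<Union>(groups_pos M D s) \<longleftrightarrow> starts D s True \<omega> \<and> \<not> starts D s False \<omega>"
proof -
  let ?R = "\<lambda>l. (\<forall>r\<in>{1..l-1}. \<not> D r True \<omega> \<and> \<not> D r False \<omega>) \<and>
      (\<forall>r\<in>{l..s-1}. \<not> D r True \<omega> \<and> D r False \<omega>) \<and> D s True \<omega> \<and> D s False \<omega>"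
  have l1: "{1..s-1} = insert 1 {2..s-1}"
    using s by auto
  have ins: "(\<exists>l\<in>{1..s-1}. P l) \<longleftrightarrow> P 1 \<or> (\<exists>l\<in>{2..s-1}. P l)" for P
    unfolding l1 by blast
  have "1 \<in> {1..s-1}"
    using s by simp
  then have "\<not> ?R 1"
    using \<omega> by (auto simp: DF_def)
  then have R: "(\<exists>l\<in>{1..s-1}. ?R l) \<longleftrightarrow> (\<exists>l\<in>{2..s-1}. ?R l)"
    using ins[of ?R] by blast
  have "starts D s True \<omega> \<and> \<not> starts D s False \<omega> \<longleftrightarrow>
      ((\<forall>r\<in>{1..s-1}. \<not> D r True \<omega> \<and> \<not> D r False \<omega>) \<and> D s True \<omega> \<and> \<not> D s False \<omega>) \<or>
      (\<exists>l\<in>{1..s-1}. ?R l)"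
    by (rule starts_difference_iff) (use mono in auto)
  also have "\<dots> \<longleftrightarrow> \<omega> \<in> \<Union>(groups_pos M D s)"
    unfolding R groups_pos_def mem_Union_groups
    using \<omega>(1) by (simp add: NT_def DF_def CO_def AT_def conj_ac del: bex_simps)
  finally show ?thesis by blast
qed

text \<open>Here the case \<open>l = 1\<close> of \<open>starts_difference_iff\<close> is a group in
  its own right, compliers up to \<open>s - 1\<close> who are always treated at \<open>s\<close>, so
  it is split off from the range of \<open>l\<close>.\<close>

lemma mem_groups_neg_iff:
  assumes \<omega>: "\<omega> \<in> space M" and s: "2 \<le> s"
    and mono: "\<And>y q r. 1 \<le> q \<Longrightarrow> q \<le> r \<Longrightarrow> r \<le> s \<Longrightarrow> D q y \<omega> \<Longrightarrow> D r y \<omega>"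
  shows "\<omega> \<in> \<Union>(groups_neg M D s) \<longleftrightarrow> starts D s False \<omega> \<and> \<not> starts D s True \<omega>"
proof -
  let ?R = "\<lambda>l. (\<forall>r\<in>{1..l-1}. \<not> D r False \<omega> \<and> \<not> D r True \<omega>) \<and>
      (\<forall>r\<in>{l..s-1}. \<not> D r False \<omega> \<and> D r True \<omega>) \<and> D s False \<omega> \<and> D s True \<omega>"
  have l1: "{1..s-1} = insert 1 {2..s-1}"
    using s by auto
  have ins: "(\<exists>l\<in>{1..s-1}. P l) \<longleftrightarrow> P 1 \<or> (\<exists>l\<in>{2..s-1}. P l)" for P
    unfolding l1 by blast
  have R: "(\<exists>l\<in>{1..s-1}. ?R l) \<longleftrightarrow> ?R 1 \<or> (\<exists>l\<in>{2..s-1}. ?R l)"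
    using ins[of ?R] .
  have "starts D s False \<omega> \<and> \<not> starts D s True \<omega> \<longleftrightarrow>
      ((\<forall>r\<in>{1..s-1}. \<not> D r False \<omega> \<and> \<not> D r True \<omega>) \<and> D s False \<omega> \<and> \<not> D s True \<omega>) \<or>
      (\<exists>l\<in>{1..s-1}. ?R l)"
    by (rule starts_difference_iff) (use mono in auto)
  also have "\<dots> \<longleftrightarrow> \<omega> \<in> \<Union>(groups_neg M D s)"
    unfolding R groups_neg_def mem_Union_groups
    using \<omega>(1) by (simp add: NT_def DF_def CO_def AT_def conj_ac disj_ac del: bex_simps)
  finally show ?thesis by blast
qed

section \<open>Contrasts of gains over start events\<close>

context iv_panel
begin

lemma groups_events:
  assumes s: "s \<in> {2..T}" and g: "g \<in> groups M D s"
  shows "g \<in> events"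
proof -
  have ev: "AT M D r \<in> events" "CO M D r \<in> events" "DF M D r \<in> events" "NT M D r \<in> events"
    if "r \<in> {1..s}" for r
  proof -
    have [measurable]: "Measurable.pred M (D r z)" for z
      using D_meas that s by auto
    show "AT M D r \<in> events" "NT M D r \<in> events"
      unfolding AT_def NT_def by measurable
    have "{\<omega> \<in> space M. D r True \<omega> \<and> \<not> D r False \<omega>} \<in> events"
      "{\<omega> \<in> space M. D r False \<omega> \<and> \<not> D r True \<omega>} \<in> events"
      by measurable
    then show "CO M D r \<in> events" "DF M D r \<in> events"
      by (simp_all add: CO_def DF_def conj_commute)
  qed
  have INT: "(\<Inter>r\<in>{a..b}. A r) \<in> events" if "a \<le> b" "\<And>r. r \<in> {a..b} \<Longrightarrow> A r \<in> events"
    for a b :: nat and A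
    using that by (intro sets.finite_INT) auto
  show ?thesis
    using g s unfolding groups_def groups_pos_def groups_neg_def
    by (elim UnE CollectE exE conjE insertE emptyE) (auto intro!: sets.Int INT ev)
qed

text \<open>\<open>measure\<close> is also 0 on non-events, so \<open>monotonicity\<close> yields a
  null set only together with measurability of the defier event.\<close>

lemma DF_1_null:
  assumes "1 \<le> T"
  shows "DF M D 1 \<in> events" and "AE \<omega> in M. \<omega> \<notin> DF M D 1"
proof -
  have [measurable]: "Measurable.pred M (D 1 z)" for z
    using D_meas assms by auto
  have "{\<omega> \<in> space M. D 1 False \<omega> \<and> \<not> D 1 True \<omega>} \<in> events"
    by measurable
  then show "DF M D 1 \<in> events"
    by (simp add: DF_def conj_commute)
  then show "AE \<omega> in M. \<omega> \<notin> DF M D 1"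
    using monotonicity by (intro AE_not_in) (auto simp: null_sets_def emeasure_eq_measure)
qed

text \<open>The pointwise descriptions hold off a null set, since persistence of the potential
  treatments and the absence of period-1 defiers are a.e. facts.\<close>

lemma start_event_diff_groups:
  assumes s: "s \<in> {2..T}"
  shows "AE \<omega> in M. \<omega> \<in> \<Union>(groups_pos M D s) \<longleftrightarrow> \<omega> \<in> start_event s True - start_event s False"
    and "AE \<omega> in M. \<omega> \<in> \<Union>(groups_neg M D s) \<longleftrightarrow> \<omega> \<in> start_event s False - start_event s True"
proof -
  have T: "1 \<le> T" and s2: "2 \<le> s" using s by auto
  have ae: "AE \<omega> in M. \<omega> \<in> space M \<and> \<omega> \<notin> DF M D 1 \<and>
      (\<forall>y q r. 1 \<le> q \<longrightarrow> q \<le> r \<longrightarrow> r \<le> s \<longrightarrow> D q y \<omega> \<longrightarrow> D r y \<omega>)"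
    using potential_irreversible_all DF_1_null(2)[OF T] AE_space
    by eventually_elim (use s in auto)
  show "AE \<omega> in M. \<omega> \<in> \<Union>(groups_pos M D s) \<longleftrightarrow> \<omega> \<in> start_event s True - start_event s False"
    using ae by eventually_elim (subst mem_groups_pos_iff[OF _ _ s2]; blast)
  show "AE \<omega> in M. \<omega> \<in> \<Union>(groups_neg M D s) \<longleftrightarrow> \<omega> \<in> start_event s False - start_event s True"
    using ae by eventually_elim (subst mem_groups_neg_iff[OF _ s2]; blast)
qed

lemma set_integral_groups:
  assumes s: "s \<in> {2..T}" and \<G>: "\<G> \<subseteq> groups M D s" "disjoint \<G>"
    and S: "S \<in> events" "AE \<omega> in M. \<omega> \<in> \<Union>\<G> \<longleftrightarrow> \<omega> \<in> S"
    and int: "integrable M X"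
    and mean: "\<And>g. g \<in> groups M D s \<Longrightarrow> 0 < prob g \<Longrightarrow> cond_mean M X g = c"
  shows "(LINT \<omega>:S|M. X \<omega>) = c * prob S"
proof -
  have fin: "finite \<G>"
    using \<G>(1) finite_groups by (rule finite_subset)
  have ev: "\<G> \<subseteq> events"
    using \<G>(1) groups_events[OF s] by blast
  then have U: "\<Union>\<G> \<in> events"
    using fin by (rule sets.finite_Union[rotated])
  have "(LINT \<omega>:S|M. X \<omega>) = (LINT \<omega>:\<Union>\<G>|M. X \<omega>)"
    using S U int unfolding set_borel_measurable_def
    by (intro set_integral_cong_set) (auto simp: set_borel_measurable_def)
  also have "\<dots> = c * prob (\<Union>\<G>)"
    by (rule set_integral_Union_cond_mean[OF fin ev \<G>(2) int]) (use mean \<G>(1) in blast)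
  also have "prob (\<Union>\<G>) = prob S"
    using S U by (intro finite_measure_eq_AE) auto
  finally show ?thesis .
qed

text \<open>Each one-sided difference of the start events is, up to a null set, a disjoint union of
  latent groups with conditional mean \<open>c\<close>; what the start events share cancels.\<close>

lemma start_contrast_later:
  assumes s: "s \<in> {2..T}" and int: "integrable M X"
    and mean: "\<And>g. g \<in> groups M D s \<Longrightarrow> 0 < prob g \<Longrightarrow> cond_mean M X g = c"
  shows "(LINT \<omega>:start_event s True|M. X \<omega>) - (LINT \<omega>:start_event s False|M. X \<omega>)
    = c * (prob (start_event s True) - prob (start_event s False))"
proof -
  have ev: "start_event s z \<in> events" for z
    using s by (intro start_event_sets) auto
  have s2: "2 \<le> s" using s by simp
  show ?thesis
    by (rule set_integral_diff_proportional[OF ev ev int];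
        rule set_integral_groups[OF s _ _ _ _ int mean])
       (use start_event_diff_groups[OF s] ev disjoint_groups_pos disjoint_groups_neg[OF s2]
        in \<open>auto simp: groups_def\<close>)
qed

text \<open>In period 1 the one-sided differences are exactly the compliers and the defiers, and the
  defiers are null.\<close>

lemma start_contrast_first:
  assumes T: "1 \<le> T" and int: "integrable M X"
    and mean: "0 < prob (CO M D 1) \<Longrightarrow> cond_mean M X (CO M D 1) = c"
  shows "(LINT \<omega>:start_event 1 True|M. X \<omega>) - (LINT \<omega>:start_event 1 False|M. X \<omega>)
    = c * (prob (start_event 1 True) - prob (start_event 1 False))"
proof -
  have ev: "start_event 1 z \<in> events" for z
    using T by (intro start_event_sets) auto
  have CO: "start_event 1 True - start_event 1 False = CO M D 1"
    and DF: "start_event 1 False - start_event 1 True = DF M D 1"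
    by (auto simp: starts_def CO_def DF_def)
  have "CO M D 1 \<in> events"
    using ev unfolding CO[symmetric] by (intro sets.Diff)
  then have "(LINT \<omega>:CO M D 1|M. X \<omega>) = c * prob (CO M D 1)"
    using mean by (rule set_integral_eq_cond_mean)
  moreover have "(LINT \<omega>:DF M D 1|M. X \<omega>) = c * prob (DF M D 1)"
    using set_integral_null_event[OF DF_1_null(1)[OF T] monotonicity] monotonicity by simp
  ultimately show ?thesis
    using set_integral_diff_proportional[OF ev ev int, of True False c] unfolding CO DF by simp
qed

end

section \<open>Inverting a lower triangular matrix\<close>

text \<open>The determinant is the product of the nonzero diagonal entries, so the matrix is a unit
  and \<open>mat_inverse\<close> succeeds.\<close>

lemma lower_triangular_mat_inverse:
  fixes A :: "'a :: field mat"
  assumes A: "A \<in> carrier_mat n n"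
    and lower: "\<And>i j. i < j \<Longrightarrow> j < n \<Longrightarrow> A $$ (i, j) = 0"
    and diag: "\<And>i. i < n \<Longrightarrow> A $$ (i, i) \<noteq> 0"
  shows "invertible_mat A"
    and "\<exists>Q. mat_inverse A = Some Q \<and> Q \<in> carrier_mat n n \<and> Q * A = 1\<^sub>m n"
proof -
  have "Determinant.det A \<noteq> 0"
    using det_lower_triangular[OF lower A] diag A
    by (auto simp: diag_mat_def prod_list_zero_iff)
  then have "A \<in> Units (ring_mat TYPE('a) n ())"
    by (rule det_non_zero_imp_unit[OF A])
  then obtain Q where Q: "mat_inverse A = Some Q"
    using mat_inverse(1)[OF A, where b = "()"] by (cases "mat_inverse A") auto
  note inv = mat_inverse(2)[OF A Q]
  show "invertible_mat A"
    using inv A unfolding invertible_mat_def inverts_mat_def by auto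
  show "\<exists>Q. mat_inverse A = Some Q \<and> Q \<in> carrier_mat n n \<and> Q * A = 1\<^sub>m n"
    using Q inv by blast
qed

section \<open>The triangular system for the effects \<Delta> and its solution\<close>

theorem proposition3p2:
  fixes M :: "'a measure" and T :: nat
    and Z :: "'a \<Rightarrow> bool" and D :: "nat \<Rightarrow> bool \<Rightarrow> 'a \<Rightarrow> bool"
    and Y0 :: "nat \<Rightarrow> bool \<Rightarrow> 'a \<Rightarrow> real" and Y1 :: "nat \<Rightarrow> nat \<Rightarrow> bool \<Rightarrow> 'a \<Rightarrow> real"
    and Y0x :: "nat \<Rightarrow> 'a \<Rightarrow> real" and Y1x :: "nat \<Rightarrow> nat \<Rightarrow> 'a \<Rightarrow> real"
    and \<Delta> :: "nat \<Rightarrow> real"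
  assumes prob: "prob_space M"
    and T: "1 \<le> T"
    and Z_meas: "Z \<in> measurable M (count_space UNIV)"
    and Z_nondeg: "0 < measure M {\<omega> \<in> space M. Z \<omega>}" "measure M {\<omega> \<in> space M. Z \<omega>} < 1"
    and D_meas: "\<And>t z. t \<in> {1..T} \<Longrightarrow> D t z \<in> measurable M (count_space UNIV)"
    and Y0_int: "\<And>t z. t \<in> {1..T} \<Longrightarrow> integrable M (Y0 t z)"
    and Y1_int: "\<And>t \<tau> z. t \<in> {1..T} \<Longrightarrow> \<tau> \<in> {..<t} \<Longrightarrow> integrable M (Y1 t \<tau> z)"
    and irreversible:
      "\<And>t. t \<in> {1..T} - {T} \<Longrightarrow> AE \<omega> in M. obs_D Z D t \<omega> \<longrightarrow> obs_D Z D (t + 1) \<omega>"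
    and exclusion0: "\<And>t z. t \<in> {1..T} \<Longrightarrow> AE \<omega> in M. Y0 t z \<omega> = Y0x t \<omega>"
    and exclusion1:
      "\<And>t \<tau> z. t \<in> {1..T} \<Longrightarrow> \<tau> \<in> {..<t} \<Longrightarrow> AE \<omega> in M. Y1 t \<tau> z \<omega> = Y1x t \<tau> \<omega>"
    and independence:
      "\<And>t. t \<in> {1..T} \<Longrightarrow>
         indep_rv M (potential_space t) (potential_vector D Y0x Y1x t) (count_space UNIV) Z"
    and relevance: "first_stage M Z D 1 \<noteq> 0"
    and monotonicity: "measure M (DF M D 1) = 0"
    and homogeneity_C1:
      "\<And>t \<tau>. t \<in> {1..T} \<Longrightarrow> \<tau> \<in> {..<t} \<Longrightarrow> causal_effect M Y0x Y1x t \<tau> (CO M D 1) = \<Delta> \<tau>"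
    and homogeneity_groups:
      "\<And>t \<tau> g. t \<in> {1..T} - {1} \<Longrightarrow> \<tau> \<in> {0..t-2} \<Longrightarrow> g \<in> groups M D (t - \<tau>) \<Longrightarrow>
         measure M g > 0 \<Longrightarrow> \<Delta> \<tau> = causal_effect M Y0x Y1x t \<tau> g"
  shows "invertible_mat (P_mat M Z D T) \<and>
    (\<exists>Q. mat_inverse (P_mat M Z D T) = Some Q \<and>
         Matrix.vec T \<Delta> = Q *\<^sub>v RF_vec M Z D Y0 Y1 T)"
proof -
  interpret prob_space M by (rule prob)
  interpret iv_panel M T Z D Y0 Y1 Y0x Y1x
    by unfold_locales (use assms in auto)
  \<comment> \<open>\<open>c 1\<close> is the first stage at period 1, and \<open>c s\<close> is
    \<open>- rho M Z D s\<close> for later \<open>s\<close>.\<close>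
  define c where "c s = prob (start_event s True) - prob (start_event s False)" for s
  have contrast: "(LINT \<omega>:start_event s True|M. gain t (t - s) \<omega>)
      - (LINT \<omega>:start_event s False|M. gain t (t - s) \<omega>) = \<Delta> (t - s) * c s"
    if t: "t \<in> {1..T}" and s: "s \<in> {1..t}" for s t
  proof (cases "s = 1")
    case True
    have "cond_mean M (gain t (t - 1)) (CO M D 1) = \<Delta> (t - 1)"
      using homogeneity_C1[OF t, of "t - 1"] t by (simp add: causal_effect_def)
    then show ?thesis
      unfolding c_def True using t by (intro start_contrast_first T gain_integrable) auto
  next
    case False
    have "cond_mean M (gain t (t - s)) g = \<Delta> (t - s)" if "g \<in> groups M D s" "0 < prob g" for g
    proof -
      \<comment> \<open>Homogeneity is applied with exposure \<open>\<tau> = t - s\<close>, so the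
        groups are those of the starting period \<open>s\<close>; \<open>s \<ge> 2\<close> is what
        bounds \<tau> by \<open>t - 2\<close>.\<close>
      have "t \<in> {1..T} - {1}" "t - s \<in> {0..t-2}" "t - (t - s) = s"
        using t s False by auto
      then show ?thesis
        using homogeneity_groups[of t "t - s" g] that by (simp add: causal_effect_def)
    qed
    then show ?thesis
      unfolding c_def using t s False by (intro start_contrast_later gain_integrable) auto
  qed
  \<comment> \<open>Column \<open>j\<close> multiplies \<open>\<Delta> j\<close>, the effect after
    \<open>j\<close> periods of exposure; in period \<open>i + 1\<close> this exposure belongs to a
    start in period \<open>i - j + 1\<close>.\<close>
  have entry: "P_mat M Z D T $$ (i, j) = (if j \<le> i then c (i - j + 1) else 0)"
    if "i < T" "j < T" for i j
  proof (cases "j < i")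
    case True
    then have "i - j + 1 \<in> {2..T}"
      using that by auto
    from rho_eq[OF this] show ?thesis
      using that True by (simp add: P_mat_def c_def)
  next
    case False
    then show ?thesis
      using that first_stage_1[OF T] by (auto simp: P_mat_def c_def)
  qed
  have carrier: "P_mat M Z D T \<in> carrier_mat T T"
    by (simp add: P_mat_def)
  have "c 1 \<noteq> 0"
    using relevance first_stage_1[OF T] by (simp add: c_def)
  then have diag: "P_mat M Z D T $$ (i, i) \<noteq> 0" if "i < T" for i
    using entry[OF that that] by simp
  have lower: "P_mat M Z D T $$ (i, j) = 0" if "i < j" "j < T" for i j
    using entry[of i j] that by simp
  \<comment> \<open>The decomposition by starting period is a convolution of \<Delta> with
    \<open>c\<close>, hence a product with a lower triangular Toeplitz matrix.\<close>
  have RF: "RF_vec M Z D Y0 Y1 T = P_mat M Z D T *\<^sub>v Matrix.vec T \<Delta>"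
  proof (rule eq_vecI)
    fix i assume "i < dim_vec (P_mat M Z D T *\<^sub>v Matrix.vec T \<Delta>)"
    then have i: "i < T" by (simp add: P_mat_def)
    have "(P_mat M Z D T *\<^sub>v Matrix.vec T \<Delta>) $ i = (\<Sum>j<T. P_mat M Z D T $$ (i, j) * \<Delta> j)"
      using i carrier by (simp add: scalar_prod_def lessThan_atLeast0)
    also have "\<dots> = (\<Sum>j<T. if j \<le> i then c (i - j + 1) * \<Delta> j else 0)"
      by (intro sum.cong) (use i entry in auto)
    also have "\<dots> = (\<Sum>j\<in>{..i}. c (i - j + 1) * \<Delta> j)"
      by (intro sum.mono_neutral_cong_right) (use i in auto)
    \<comment> \<open>Change of index from exposure \<open>j\<close> to starting period
      \<open>s = i + 1 - j\<close>.\<close>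
    also have "\<dots> = (\<Sum>s\<in>{1..i+1}. \<Delta> (i + 1 - s) * c s)"
      by (rule sum.reindex_bij_witness[of _ "\<lambda>s. i + 1 - s" "\<lambda>j. i + 1 - j"])
         (auto simp: Suc_diff_le)
    also have "\<dots> = reduced_form M Z D Y0 Y1 (i + 1)"
      using i contrast[of "i + 1"] by (subst reduced_form_eq) (auto intro!: sum.cong)
    finally show "RF_vec M Z D Y0 Y1 T $ i = (P_mat M Z D T *\<^sub>v Matrix.vec T \<Delta>) $ i"
      using i by (simp add: RF_vec_def)
  qed (simp add: RF_vec_def P_mat_def)
  obtain Q where Q: "mat_inverse (P_mat M Z D T) = Some Q" "Q \<in> carrier_mat T T"
      "Q * P_mat M Z D T = 1\<^sub>m T"
    using lower_triangular_mat_inverse(2)[OF carrier lower diag] by blast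
  have "Q *\<^sub>v RF_vec M Z D Y0 Y1 T = Q * P_mat M Z D T *\<^sub>v Matrix.vec T \<Delta>"
    unfolding RF using Q(2) carrier by (subst assoc_mult_mat_vec) auto
  also have "\<dots> = Matrix.vec T \<Delta>"
    using Q(3) by simp
  finally show ?thesis
    using Q(1) lower_triangular_mat_inverse(1)[OF carrier lower diag] by auto
qed

end
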